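(* Let $-D\le C<D\le 1$ and let $f(z)=z+\sum_{m=2}^{\infty}a_m z^m+\overline{\sum_{m=2}^{\infty}b_m z^m}\in\mathcal{S}^{c}_{\tau}(C,D)$. Then $$r-\frac{D-C}{2(1+2D-C)}r^2\le|f(z)|\le r+\frac{D-C}{2(1+2D-C)}r^2\qquad(|z|=r<1)$$ and $$|z|+\sum_{m=2}^\infty(|a_m|+|b_m|)|z|^m\le d(f(0),\partial f(\mathbb{D}))$$ for $|z|\le r^*$, where, with $\alpha_2=1+2D-C$, $$r^*=\frac{-1+\sqrt{1+2\left(\frac{D-C}{\alpha_2}\right)\left(1-\frac{D-C}{2\alpha_2}\right)}}{\left(\frac{D-C}{\alpha_2}\right)}.$$ The radius $r^*$ is the Bohr radius of the class (the largest radius for which the last inequality holds for all members of $\mathcal{S}^{c}_{\tau}(C,D)$), and it is achieved by the function $f(z)=z-\frac{D-C}{2(1+2D-C)}z^2$.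
   Context: $\mathbb{D}=\{z\in\mathbb{C}:|z|<1\}$; $d(f(0),\partial f(\mathbb{D}))$ is the Euclidean distance from $f(0)$ to the boundary of $f(\mathbb{D})$. $\mathcal{H}_0$ is the class of complex-valued harmonic functions $f=h+\bar g$ on $\mathbb{D}$ with $h(z)=z+\sum_{m=2}^\infty a_mz^m$ and $g(z)=\sum_{m=2}^\infty b_mz^m$ analytic in $\mathbb{D}$; $\mathcal{S}^0_{\mathcal{H}}$ is the class of univalent (injective) functions in $\mathcal{H}_0$. $\tau^1$ is the class of those $f\in\mathcal{H}_0$ with $a_m=-|a_m|$ and $b_m=-|b_m|$ for all $m\ge2$. For $f\in\mathcal{H}_0$ put $\mathcal{D}_{\mathcal{H}}f(z)=zh'(z)-\overline{zg'(z)}$. For a function $q$ on $\mathbb{D}$ and a univalent analytic $\phi$ on $\mathbb{D}$, $q\prec\phi$ means $q(0)=\phi(0)$ and $q(\mathbb{D})\subseteq\phi(\mathbb{D})$. $\mathcal{S}^{*}_{\mathcal{H}}(C,D)$ is the class of $F\in\mathcal{H}_0$ such that $\frac{\mathcal{D}_{\mathcal{H}}F(z)}{F(z)}\prec\frac{1+Cz}{1+Dz}$ (the quotient being well defined on $\mathbb{D}\setminus\{0\}$ and taken to be $1$ at $z=0$). $\mathcal{S}^{c}_{\mathcal{H}}(C,D)$ is the class of $f\in\mathcal{S}^0_{\mathcal{H}}$ with $\mathcal{D}_{\mathcal{H}}f\in\mathcal{S}^{*}_{\mathcal{H}}(C,D)$, and $\mathcal{S}^{c}_\tau(C,D)=\tau^1\cap\mathcal{S}^{c}_{\mathcal{H}}(C,D)$.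 *)

theory Defs
  imports "HOL-Complex_Analysis.Complex_Analysis"
begin

abbreviation disc :: "complex set" ("\<D>")
  where "\<D> \<equiv> ball 0 1"

definition tail_series :: "(nat \<Rightarrow> complex) \<Rightarrow> complex \<Rightarrow> complex"
  where "tail_series c z = (\<Sum>m. c (m + 2) * z ^ (m + 2))"

definition tail_converges :: "(nat \<Rightarrow> complex) \<Rightarrow> bool"
  where "tail_converges c \<longleftrightarrow> (\<forall>z\<in>\<D>. summable (\<lambda>m. c (m + 2) * z ^ (m + 2)))"

definition h_part :: "(nat \<Rightarrow> complex) \<Rightarrow> complex \<Rightarrow> complex"
  where "h_part a z = z + tail_series a z"

definition g_part :: "(nat \<Rightarrow> complex) \<Rightarrow> complex \<Rightarrow> complex"
  where "g_part b z = tail_series b z"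

text \<open>On the unit disc, \<open>f = h + cnj g\<close> with \<open>h\<close>, \<open>g\<close> the analytic functions with Taylor
  coefficients \<open>a\<close>, \<open>b\<close>. The values \<open>a 0, a 1, b 0, b 1\<close> are never used; all others are
  determined by \<open>f\<close>. Functions are total, but only their values on the disc matter.\<close>

definition harmonic_coeffs ::
    "(complex \<Rightarrow> complex) \<Rightarrow> (nat \<Rightarrow> complex) \<Rightarrow> (nat \<Rightarrow> complex) \<Rightarrow> bool"
  where "harmonic_coeffs f a b \<longleftrightarrow> tail_converges a \<and> tail_converges b \<and>
           (\<forall>z\<in>\<D>. f z = h_part a z + cnj (g_part b z))"

definition H0 :: "(complex \<Rightarrow> complex) set"
  where "H0 = {f. \<exists>a b. harmonic_coeffs f a b}"

definition SH0 :: "(complex \<Rightarrow> complex) set"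
  where "SH0 = {f \<in> H0. inj_on f \<D>}"

definition tau1 :: "(complex \<Rightarrow> complex) set"
  where "tau1 = {f. \<exists>a b. harmonic_coeffs f a b \<and>
           (\<forall>m\<ge>2. a m = - complex_of_real (cmod (a m)) \<and> b m = - complex_of_real (cmod (b m)))}"

text \<open>The description is proper for \<open>f\<close> in \<open>H0\<close> and \<open>z\<close> in the disc, since \<open>f\<close> determines
  \<open>h'\<close> and \<open>g'\<close> there; see \<open>DH_eq\<close> below.\<close>

definition DH :: "(complex \<Rightarrow> complex) \<Rightarrow> complex \<Rightarrow> complex"
  where "DH f z = (THE w. \<exists>a b. harmonic_coeffs f a b \<and>
           w = z * deriv (h_part a) z - cnj (z * deriv (g_part b) z))"

text \<open>Used only for univalent analytic \<open>\<phi>\<close>.\<close>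

definition subordinate :: "(complex \<Rightarrow> complex) \<Rightarrow> (complex \<Rightarrow> complex) \<Rightarrow> bool" (infix "\<prec>\<^sub>s" 50)
  where "q \<prec>\<^sub>s \<phi> \<longleftrightarrow> q 0 = \<phi> 0 \<and> q ` \<D> \<subseteq> \<phi> ` \<D>"

text \<open>Since division by zero yields \<open>0\<close>, well-definedness of the quotient away from the origin
  is an explicit requirement.\<close>

definition SstarH :: "real \<Rightarrow> real \<Rightarrow> (complex \<Rightarrow> complex) set"
  where "SstarH C D = {F \<in> H0. (\<forall>z\<in>\<D> - {0}. F z \<noteq> 0) \<and>
           (\<lambda>z. if z = 0 then 1 else DH F z / F z)
             \<prec>\<^sub>s (\<lambda>z. (1 + of_real C * z) / (1 + of_real D * z))}"

definition ScH :: "real \<Rightarrow> real \<Rightarrow> (complex \<Rightarrow> complex) set"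
  where "ScH C D = {f \<in> SH0. DH f \<in> SstarH C D}"

definition Sc_tau :: "real \<Rightarrow> real \<Rightarrow> (complex \<Rightarrow> complex) set"
  where "Sc_tau C D = tau1 \<inter> ScH C D"

text \<open>For \<open>0 \<le> r < 1\<close> and coefficients as in \<open>harmonic_coeffs\<close> this series converges, since the
  two power series converge absolutely in the disc.\<close>

definition bohr_sum :: "(nat \<Rightarrow> complex) \<Rightarrow> (nat \<Rightarrow> complex) \<Rightarrow> real \<Rightarrow> real"
  where "bohr_sum a b r = r + (\<Sum>m. (cmod (a (m + 2)) + cmod (b (m + 2))) * r ^ (m + 2))"

definition boundary_dist :: "(complex \<Rightarrow> complex) \<Rightarrow> real"
  where "boundary_dist f = infdist (f 0) (frontier (f ` \<D>))"

definition bohr_radii :: "(complex \<Rightarrow> complex) set \<Rightarrow> real set"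
  where "bohr_radii \<F> = {\<rho>. 0 < \<rho> \<and> \<rho> < 1 \<and>
           (\<forall>f\<in>\<F>. \<forall>a b. harmonic_coeffs f a b \<longrightarrow>
              (\<forall>z. cmod z \<le> \<rho> \<longrightarrow> bohr_sum a b (cmod z) \<le> boundary_dist f))}"

definition is_bohr_radius :: "(complex \<Rightarrow> complex) set \<Rightarrow> real \<Rightarrow> bool"
  where "is_bohr_radius \<F> \<rho> \<longleftrightarrow> \<rho> \<in> bohr_radii \<F> \<and> (\<forall>\<rho>'\<in>bohr_radii \<F>. \<rho>' \<le> \<rho>)"

lemma tail_series_holomorphic:
  assumes "tail_converges c"
  shows "tail_series c holomorphic_on \<D>"
proof (rule power_series_holomorphic)
  fix w assume w: "w \<in> \<D>"
  let ?c = "\<lambda>n. if n < 2 then 0 else c n"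
  have "(\<lambda>m. ?c (m + 2) * w ^ (m + 2)) sums tail_series c w"
    using assms w by (simp add: tail_converges_def tail_series_def summable_sums)
  then have "(\<lambda>n. ?c n * w ^ n) sums (tail_series c w + (\<Sum>i<2. ?c i * w ^ i))"
    by (subst (asm) sums_iff_shift)
  then show "(\<lambda>n. ?c n * (w - 0) ^ n) sums tail_series c w" by simp
qed

lemma DH_eq:
  assumes ab: "harmonic_coeffs f a b" and z: "z \<in> \<D>"
  shows "DH f z = z * deriv (h_part a) z - cnj (z * deriv (g_part b) z)"
proof -
  have hol: "h_part c holomorphic_on \<D>" "g_part c holomorphic_on \<D>" if "tail_converges c" for c
    unfolding h_part_def[abs_def] g_part_def[abs_def]
    by (intro holomorphic_intros tail_series_holomorphic that)+
  have unique: "deriv (h_part a') z = deriv (h_part a) z \<and> deriv (g_part b') z = deriv (g_part b) z"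
    if ab': "harmonic_coeffs f a' b'" for a' b'
  proof -
    define u where "u = (\<lambda>w. h_part a' w - h_part a w)"
    define v where "v = (\<lambda>w. g_part b w - g_part b' w)"
    define p where "p = deriv (h_part a') z - deriv (h_part a) z"
    define q where "q = deriv (g_part b) z - deriv (g_part b') z"
    have D: "(k has_field_derivative deriv k z) (at z)" if "k holomorphic_on \<D>" for k
      using that z holomorphic_derivI open_ball by blast
    have u: "(u has_field_derivative p) (at z)" and v: "(v has_field_derivative q) (at z)"
      using ab ab' unfolding u_def v_def p_def q_def harmonic_coeffs_def
      by (auto intro!: DERIV_diff D hol)
    have eq: "u w = cnj (v w)" if "w \<in> \<D>" for w
    proof -
      have "h_part a' w + cnj (g_part b' w) = h_part a w + cnj (g_part b w)"
        using ab ab' that unfolding harmonic_coeffs_def by metis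
      then show ?thesis unfolding u_def v_def by (simp add: algebra_simps)
    qed
    have 1: "(u has_derivative (\<lambda>x. p * x)) (at z)"
      using u by (simp add: has_field_derivative_def)
    have "((\<lambda>w. cnj (v w)) has_derivative (\<lambda>x. cnj (q * x))) (at z)"
      using v by (intro has_derivative_cnj) (simp add: has_field_derivative_def)
    then have 2: "(u has_derivative (\<lambda>x. cnj (q * x))) (at z)"
      by (rule has_derivative_transform_within_open[OF _ open_ball z]) (simp add: eq)
    have "(\<lambda>x. p * x) = (\<lambda>x. cnj (q * x))"
      using has_derivative_unique[OF 1 2] .
    then have "p * 1 = cnj (q * 1)" "p * \<i> = cnj (q * \<i>)" by metis+
    then have "p = 0" "q = 0" by (auto simp: complex_eq_iff)
    then show ?thesis by (simp add: p_def q_def)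
  qed
  show ?thesis
    unfolding DH_def
  proof (rule the_equality)
    show "\<exists>a' b'. harmonic_coeffs f a' b' \<and>
            z * deriv (h_part a) z - cnj (z * deriv (g_part b) z) =
            z * deriv (h_part a') z - cnj (z * deriv (g_part b') z)"
      using ab by blast
  next
    fix w assume "\<exists>a' b'. harmonic_coeffs f a' b' \<and>
            w = z * deriv (h_part a') z - cnj (z * deriv (g_part b') z)"
    then show "w = z * deriv (h_part a) z - cnj (z * deriv (g_part b) z)"
      using unique by metis
  qed
qed

end

(* A function f = h + cnj g of the class has coefficients a m = -|a m| and b m = -|b m|, so on the
   positive real axis DH f and DH (DH f) are real and the subordination reduces to a single
   inequality between power series with nonnegative coefficients. Letting r tend to 1 in it bounds
   the sum of all |a m| + |b m| by k = (D - C) / (2 (1 + 2 D - C)), which yields the growth estimate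
   and, as f is a homeomorphism onto its image, that the boundary of the image is at distance at
   least 1 - k from 0. The Bohr radius is the positive root of r + k r^2 = 1 - k; for
   z - k z^2 all the inequalities are equalities. *)

theory Submission
  imports Defs
begin

section \<open>Power series without constant and linear term\<close>

lemma tail_series_sums:
  assumes "tail_converges c" "z \<in> \<D>"
  shows "(\<lambda>m. c (m + 2) * z ^ (m + 2)) sums tail_series c z"
  using assms by (auto simp: tail_converges_def tail_series_def intro: summable_sums)

text \<open>Padding with zeros at the indices 0 and 1 gives a series indexed from 0, the form in
  which termwise differentiation and isolation of zeros apply.\<close>

lemma tail_series_sums_full:
  assumes "tail_converges c" "z \<in> \<D>"
  shows "(\<lambda>n. (if n < 2 then 0 else c n) * z ^ n) sums tail_series c z"
proof -
  let ?c = "\<lambda>n. if n < 2 then 0 else c n"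
  have "(\<lambda>m. ?c (m + 2) * z ^ (m + 2)) sums tail_series c z"
    using tail_series_sums[OF assms] by simp
  then have "(\<lambda>n. ?c n * z ^ n) sums (tail_series c z + (\<Sum>i<2. ?c i * z ^ i))"
    by (subst (asm) sums_iff_shift)
  then show ?thesis by simp
qed

lemma tail_series_0 [simp]: "tail_series c 0 = 0"
  by (simp add: tail_series_def)

text \<open>Termwise differentiation lowers the exponent by one and the factor \<open>z\<close>
  restores it, so z d/dz acts on coefficients as multiplication by \<open>m\<close> and yields a
  tail series again. This turns \<open>DH\<close> into an operation on coefficients.\<close>

lemma z_deriv_tail_series:
  assumes c: "tail_converges c"
  shows "tail_converges (\<lambda>m. of_nat m * c m)"
    and "z \<in> \<D> \<Longrightarrow> (tail_series c has_field_derivative deriv (tail_series c) z) (at z)"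
    and "z \<in> \<D> \<Longrightarrow> z * deriv (tail_series c) z = tail_series (\<lambda>m. of_nat m * c m) z"
proof -
  let ?c = "\<lambda>n. if n < 2 then 0 else c n"
  have D: "(tail_series c has_field_derivative deriv (tail_series c) z) (at z)" if "z \<in> \<D>" for z
    using tail_series_holomorphic[OF c] that by (intro holomorphic_derivI[where S = \<D>]) auto
  then show "z \<in> \<D> \<Longrightarrow> (tail_series c has_field_derivative deriv (tail_series c) z) (at z)" .
  have main: "(\<lambda>m. of_nat (m + 2) * c (m + 2) * z ^ (m + 2)) sums (z * deriv (tail_series c) z)"
    if z: "z \<in> \<D>" for z
  proof -
    have sm: "summable (\<lambda>n. ?c n * w ^ n)" if "norm w < 1" for w
      using tail_series_sums_full[OF c, of w] that by (auto simp: sums_iff)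
    have "((\<lambda>w. \<Sum>n. ?c n * w ^ n) has_field_derivative (\<Sum>n. diffs ?c n * z ^ n)) (at z)"
      using z by (intro termdiffs_strong'[of 1] sm) auto
    then have "(tail_series c has_field_derivative (\<Sum>n. diffs ?c n * z ^ n)) (at z)"
      by (rule has_field_derivative_transform_within_open[OF _ open_ball z])
         (use tail_series_sums_full[OF c] in \<open>auto simp: sums_iff\<close>)
    then have eq: "deriv (tail_series c) z = (\<Sum>n. diffs ?c n * z ^ n)"
      by (rule DERIV_imp_deriv)
    have "summable (\<lambda>n. diffs ?c n * z ^ n)"
      using z by (intro termdiff_converges[of z 1] sm) auto
    then have "(\<lambda>n. z * (diffs ?c n * z ^ n)) sums (z * deriv (tail_series c) z)"
      unfolding eq by (intro sums_mult summable_sums)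
    then have "(\<lambda>n. (of_nat (Suc n) * ?c (Suc n)) * z ^ Suc n) sums (z * deriv (tail_series c) z)"
      by (simp add: diffs_def mult_ac)
    \<comment> \<open>The shift drops the term of exponent 1, which is zero because
      \<open>?c\<close> vanishes at index 1.\<close>
    then have "(\<lambda>n. (of_nat (Suc (Suc n)) * ?c (Suc (Suc n))) * z ^ Suc (Suc n)) sums
        (z * deriv (tail_series c) z)"
      by (subst sums_Suc_iff) simp
    then show ?thesis by (simp add: mult_ac)
  qed
  show 1: "tail_converges (\<lambda>m. of_nat m * c m)"
    unfolding tail_converges_def using main by (auto simp: sums_iff)
  show "z \<in> \<D> \<Longrightarrow> z * deriv (tail_series c) z = tail_series (\<lambda>m. of_nat m * c m) z"
    using sums_unique2[OF main tail_series_sums[OF 1]] by blast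
qed

text \<open>A power series with a nonzero coefficient has no zeros in some punctured neighbourhood
  of the origin.\<close>

lemma tail_series_eq_0:
  assumes c: "tail_converges c" and 0: "\<And>z. z \<in> \<D> \<Longrightarrow> tail_series c z = 0" and m: "m \<ge> 2"
  shows "c m = 0"
proof (rule ccontr)
  assume "c m \<noteq> 0"
  obtain s where s: "0 < s" "\<And>z. z \<in> cball 0 s - {0} \<Longrightarrow> tail_series c z \<noteq> 0"
  proof (rule powser_0_nonzero[of 1 0 "\<lambda>n. if n < 2 then 0 else c n" "tail_series c" m])
    show "(\<lambda>n. (if n < 2 then 0 else c n) * (x - 0) ^ n) sums tail_series c x"
      if "norm (x - 0) < 1" for x
      using tail_series_sums_full[OF c, of x] that by simp
  qed (use \<open>c m \<noteq> 0\<close> m in auto)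
  define x where "x = complex_of_real (min s (1/2))"
  have "x \<in> cball 0 s - {0}" "x \<in> \<D>" using s(1) by (auto simp: x_def)
  then show False using s(2) 0 by blast
qed

lemma tail_converges_diff:
  assumes "tail_converges c" "tail_converges d"
  shows "tail_converges (\<lambda>m. c m - d m)"
    and "z \<in> \<D> \<Longrightarrow> tail_series (\<lambda>m. c m - d m) z = tail_series c z - tail_series d z"
proof -
  have main: "(\<lambda>m. (c (m + 2) - d (m + 2)) * z ^ (m + 2)) sums (tail_series c z - tail_series d z)"
    if "z \<in> \<D>" for z
    using sums_diff[OF tail_series_sums[OF assms(1) that] tail_series_sums[OF assms(2) that]]
    by (simp add: algebra_simps)
  show "tail_converges (\<lambda>m. c m - d m)"
    unfolding tail_converges_def using main by (auto simp: sums_iff)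
  show "z \<in> \<D> \<Longrightarrow> tail_series (\<lambda>m. c m - d m) z = tail_series c z - tail_series d z"
    using main[of z] by (simp add: tail_series_def sums_iff)
qed

lemma tail_converges_minus:
  assumes "tail_converges c"
  shows "tail_converges (\<lambda>m. - c m)"
    and "z \<in> \<D> \<Longrightarrow> tail_series (\<lambda>m. - c m) z = - tail_series c z"
proof -
  have main: "(\<lambda>m. (- c (m + 2)) * z ^ (m + 2)) sums (- tail_series c z)" if "z \<in> \<D>" for z
    using sums_minus[OF tail_series_sums[OF assms that]] by simp
  show "tail_converges (\<lambda>m. - c m)"
    unfolding tail_converges_def using main by (auto simp: sums_iff)
  show "z \<in> \<D> \<Longrightarrow> tail_series (\<lambda>m. - c m) z = - tail_series c z"
    using main[of z] by (simp add: tail_series_def sums_iff)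
qed

section \<open>Harmonic functions and their coefficients\<close>

lemma harmonic_coeffs_continuous:
  assumes "harmonic_coeffs f a b"
  shows "continuous_on \<D> f"
proof -
  have "continuous_on \<D> (\<lambda>z. h_part a z + cnj (g_part b z))"
    using assms unfolding h_part_def g_part_def harmonic_coeffs_def
    by (intro continuous_intros holomorphic_on_imp_continuous_on tail_series_holomorphic) auto
  then show ?thesis
    by (rule continuous_on_eq) (use assms in \<open>simp add: harmonic_coeffs_def\<close>)
qed

text \<open>Membership in \<open>tau1\<close> fixes the signs of one pair of coefficient sequences
  only, while the theorem speaks of every pair; uniqueness transfers the signs. Two representations
  differ by holomorphic \<open>u\<close> and \<open>v\<close> with \<open>u = cnj v\<close>, which
  forces \<open>u\<close> to be constant, hence zero.\<close>

lemma harmonic_coeffs_unique: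
  assumes ab: "harmonic_coeffs f a b" and ab': "harmonic_coeffs f a' b'" and "m \<ge> 2"
  shows "a m = a' m \<and> b m = b' m"
proof -
  define u v where "u = tail_series (\<lambda>m. a m - a' m)" and "v = tail_series (\<lambda>m. b' m - b m)"
  have ca: "tail_converges (\<lambda>m. a m - a' m)" and cb: "tail_converges (\<lambda>m. b' m - b m)"
    using ab ab' by (auto simp: harmonic_coeffs_def intro: tail_converges_diff)
  have eq: "u w = cnj (v w)" if "w \<in> \<D>" for w
  proof -
    have "h_part a w + cnj (g_part b w) = h_part a' w + cnj (g_part b' w)"
      using ab ab' that unfolding harmonic_coeffs_def by metis
    moreover have "u w = tail_series a w - tail_series a' w" "v w = tail_series b' w - tail_series b w"
      using ab ab' that by (auto simp: u_def v_def harmonic_coeffs_def tail_converges_diff)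
    ultimately show ?thesis by (simp add: h_part_def g_part_def complex_eq_iff)
  qed
  \<comment> \<open>A holomorphic function whose conjugate is holomorphic has a derivative that is both
    complex linear and conjugate linear.\<close>
  have du: "deriv u z = 0" if z: "z \<in> \<D>" for z
  proof -
    have 1: "(u has_derivative (\<lambda>x. deriv u z * x)) (at z)"
      using z_deriv_tail_series(2)[OF ca z] by (simp add: has_field_derivative_def u_def)
    have "((\<lambda>w. cnj (v w)) has_derivative (\<lambda>x. cnj (deriv v z * x))) (at z)"
      using z_deriv_tail_series(2)[OF cb z]
      by (intro has_derivative_cnj) (simp add: has_field_derivative_def v_def)
    then have 2: "(u has_derivative (\<lambda>x. cnj (deriv v z * x))) (at z)"
      by (rule has_derivative_transform_within_open[OF _ open_ball z]) (simp add: eq)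
    have "(\<lambda>x. deriv u z * x) = (\<lambda>x. cnj (deriv v z * x))"
      using has_derivative_unique[OF 1 2] .
    then have "deriv u z * 1 = cnj (deriv v z * 1)" "deriv u z * \<i> = cnj (deriv v z * \<i>)" by metis+
    then show ?thesis by (auto simp: complex_eq_iff)
  qed
  have u0: "u z = 0" if "z \<in> \<D>" for z
  proof -
    have "\<exists>k. \<forall>x\<in>\<D>. u x = k"
    proof (intro has_field_derivative_zero_constant convex_ball)
      show "(u has_field_derivative 0) (at x within \<D>)" if "x \<in> \<D>" for x
        using z_deriv_tail_series(2)[OF ca that] du[OF that]
        by (auto simp: u_def intro: has_field_derivative_at_within)
    qed
    then show ?thesis using that by (metis centre_in_ball tail_series_0 u_def zero_less_one)
  qed
  have v0: "v z = 0" if "z \<in> \<D>" for z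
    using eq[OF that] u0[OF that] by simp
  show ?thesis
    using tail_series_eq_0[OF ca u0[unfolded u_def] \<open>m \<ge> 2\<close>]
      tail_series_eq_0[OF cb v0[unfolded v_def] \<open>m \<ge> 2\<close>] by simp
qed

lemma deriv_parts:
  assumes "z \<in> \<D>" "tail_converges c"
  shows "deriv (h_part c) z = 1 + deriv (tail_series c) z"
    and "deriv (g_part c) z = deriv (tail_series c) z"
  unfolding h_part_def[abs_def] g_part_def[abs_def]
  using z_deriv_tail_series(2)[OF assms(2,1)] by (auto intro!: DERIV_imp_deriv derivative_eq_intros)

text \<open>The conjugate part enters \<open>DH\<close> with a minus sign, whence the sign on
  \<open>b\<close>. A second application gives the factors m^2 on both sequences, with the signs
  cancelling.\<close>

lemma DH_coeffs:
  assumes ab: "harmonic_coeffs f a b"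
  shows "harmonic_coeffs (DH f) (\<lambda>m. of_nat m * a m) (\<lambda>m. - (of_nat m * b m))"
proof -
  have "tail_converges a" "tail_converges b" using ab by (auto simp: harmonic_coeffs_def)
  then show ?thesis
    using z_deriv_tail_series(1,3)[of a] z_deriv_tail_series(1,3)[of b]
    unfolding harmonic_coeffs_def
    by (auto simp: tail_converges_minus DH_eq[OF ab] deriv_parts h_part_def g_part_def algebra_simps)
qed

lemma tail_series_Re_sums:
  assumes "tail_converges c" "0 \<le> r" "r < 1"
  shows "(\<lambda>m. Re (c (m + 2)) * r ^ (m + 2)) sums Re (tail_series c (of_real r))"
proof -
  have "(\<lambda>m. Re (c (m + 2) * of_real r ^ (m + 2))) sums Re (tail_series c (of_real r))"
    using assms by (intro sums_Re tail_series_sums) auto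
  then show ?thesis by (simp flip: of_real_power of_real_add)
qed

text \<open>Conjugation does not affect real parts, so on the real axis \<open>a\<close> and
  \<open>b\<close> contribute alike.\<close>

lemma harmonic_coeffs_Re_sums:
  assumes "harmonic_coeffs f a b" "0 \<le> r" "r < 1"
  shows "(\<lambda>m. Re (a (m + 2) + b (m + 2)) * r ^ (m + 2)) sums (Re (f (of_real r)) - r)"
proof -
  have "(\<lambda>m. Re (a (m + 2)) * r ^ (m + 2) + Re (b (m + 2)) * r ^ (m + 2)) sums
          (Re (tail_series a (of_real r)) + Re (tail_series b (of_real r)))"
    using assms by (intro sums_add tail_series_Re_sums) (auto simp: harmonic_coeffs_def)
  moreover have "f (of_real r) = h_part a (of_real r) + cnj (g_part b (of_real r))"
    using assms by (auto simp: harmonic_coeffs_def)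
  ultimately show ?thesis by (simp add: h_part_def g_part_def algebra_simps)
qed

lemma harmonic_real_on_axis:
  assumes ab: "harmonic_coeffs f a b" and real: "\<And>m. m \<ge> 2 \<Longrightarrow> Im (a m) = 0 \<and> Im (b m) = 0"
    and r: "0 \<le> r" "r < 1"
  shows "Im (f (of_real r)) = 0"
proof -
  have *: "Im (tail_series c (of_real r)) = 0"
    if c: "tail_converges c" "\<And>m. m \<ge> 2 \<Longrightarrow> Im (c m) = 0" for c
  proof -
    have "(\<lambda>m. Im (c (m + 2) * of_real r ^ (m + 2))) sums Im (tail_series c (of_real r))"
      using r c by (intro sums_Im tail_series_sums) auto
    moreover have "(\<lambda>m. Im (c (m + 2) * of_real r ^ (m + 2))) = (\<lambda>m. 0)"
      using c(2) by (auto simp flip: of_real_power of_real_add)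
    ultimately show ?thesis by (simp add: sums_iff)
  qed
  moreover have "f (of_real r) = h_part a (of_real r) + cnj (g_part b (of_real r))"
    using ab r by (auto simp: harmonic_coeffs_def)
  ultimately show ?thesis
    using ab real by (simp add: h_part_def g_part_def harmonic_coeffs_def)
qed

section \<open>The coefficient inequality\<close>

text \<open>The bound is the value of the Moebius map at the boundary point 1, the leftmost point of
  the closure of the image. Subtracting it leaves a positive multiple of (1 - z) times the conjugate
  of the denominator.\<close>

lemma Re_janowski_gt:
  fixes C D :: real
  assumes "0 < D" "D \<le> 1" "C < D" "z \<in> \<D>"
  shows "(1 + C) / (1 + D) < Re ((1 + of_real C * z) / (1 + of_real D * z))"
proof -
  have z: "cmod z < 1" using assms by simp
  have "cmod (of_real D * z) < 1"
    using assms z mult_left_le_one_le[of "cmod z" D] by (simp add: norm_mult)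
  then have nz: "1 + of_real D * z \<noteq> 0"
    by (metis add_eq_0_iff norm_minus_cancel norm_one order_less_irrefl)
  have eq: "(1 + of_real C * z) / (1 + of_real D * z) - of_real ((1 + C) / (1 + D))
      = of_real ((D - C) / (1 + D) / (cmod (1 + of_real D * z))\<^sup>2) * ((1 - z) * cnj (1 + of_real D * z))"
  proof -
    have "1 + complex_of_real D \<noteq> 0" using assms by (simp add: complex_eq_iff)
    then have "(1 + of_real C * z) / (1 + of_real D * z) - of_real ((1 + C) / (1 + D))
        = of_real ((D - C) / (1 + D)) * ((1 - z) / (1 + of_real D * z))"
      using nz by (simp add: divide_simps) (simp add: algebra_simps)
    also have "(1 - z) / (1 + of_real D * z)
        = (1 - z) * cnj (1 + of_real D * z) / of_real ((cmod (1 + of_real D * z))\<^sup>2)"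
      by (metis complex_div_cnj)
    finally show ?thesis by (simp only: of_real_divide times_divide_eq_left times_divide_eq_right)
  qed
  \<comment> \<open>In this splitting neither summand is negative. The weight \<open>1 - D\<close>
    may be zero, so strict positivity comes from the summand with weight \<open>D\<close>.\<close>
  have "Re ((1 - z) * cnj (1 + of_real D * z)) = (1 - D) * (1 - Re z) + D * (1 - (cmod z)\<^sup>2)"
    unfolding cmod_power2 by (simp add: algebra_simps power2_eq_square)
  also have "\<dots> > 0"
  proof -
    have "Re z < 1" using z complex_Re_le_cmod[of z] by linarith
    moreover have "(cmod z)\<^sup>2 < 1" using z by (simp add: abs_square_less_1)
    ultimately show ?thesis using assms by (intro add_nonneg_pos mult_nonneg_nonneg mult_pos_pos) auto
  qed
  finally have pos: "0 < Re ((1 - z) * cnj (1 + of_real D * z))" .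
  have Re_mult: "Re (of_real x * w) = x * Re w" for x w by simp
  have "0 < Re ((1 + of_real C * z) / (1 + of_real D * z) - of_real ((1 + C) / (1 + D)))"
    unfolding eq Re_mult
    using assms nz pos by (intro mult_pos_pos divide_pos_pos) auto
  then show ?thesis by simp
qed

text \<open>For real s, \<open>DH f\<close> equals s times \<open>k\<close>, where \<open>k\<close>
  is continuous with value 1 at 0. On the open interval from 0 to 1 it is real and nonzero, so the
  intermediate value theorem excludes a change of sign.\<close>

lemma DH_positive_on_axis:
  assumes ab: "harmonic_coeffs f a b" and real: "\<And>m. m \<ge> 2 \<Longrightarrow> Im (a m) = 0 \<and> Im (b m) = 0"
    and nz: "\<And>z. z \<in> \<D> - {0} \<Longrightarrow> DH f z \<noteq> 0" and r: "0 < r" "r < 1"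
  shows "0 < Re (DH f (of_real r))"
proof -
  have hol: "tail_series c holomorphic_on \<D>" if "c \<in> {a, b}" for c
    using that ab by (auto simp: harmonic_coeffs_def intro: tail_series_holomorphic)
  define k where "k = (\<lambda>z. 1 + deriv (tail_series a) z - cnj (deriv (tail_series b) z))"
  have cont: "continuous_on \<D> k"
    unfolding k_def
    by (intro continuous_intros holomorphic_on_imp_continuous_on holomorphic_deriv hol) auto
  have DH: "DH f (of_real s) = of_real s * k (of_real s)" if "0 \<le> s" "s < 1" for s
    using that ab DH_eq[OF ab, of "of_real s"]
    by (simp add: k_def deriv_parts harmonic_coeffs_def algebra_simps)
  have ck: "continuous_on {0..r} (\<lambda>s. Re (k (of_real s)))"
    by (intro continuous_intros continuous_on_compose2[OF cont]) (use r in auto)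
  have "Im (DH f (of_real s)) = 0" if "0 \<le> s" "s < 1" for s
    by (rule harmonic_real_on_axis[OF DH_coeffs[OF ab] _ that]) (use real in auto)
  then have knz: "Re (k (of_real s)) \<noteq> 0" if "0 < s" "s < 1" for s
    using nz[of "of_real s"] DH[of s] that by (auto simp: complex_eq_iff)
  \<comment> \<open>At 0 the differentiated series reduces to the coefficient of index 1, which is
    zero in the padded sequence.\<close>
  have d0: "deriv (tail_series c) 0 = 0" if c: "tail_converges c" for c
  proof -
    have "((\<lambda>w. \<Sum>n. (if n < 2 then 0 else c n) * w ^ n) has_field_derivative
            (\<Sum>n. diffs (\<lambda>n. if n < 2 then 0 else c n) n * 0 ^ n)) (at 0)"
      using tail_series_sums_full[OF c]
      by (intro termdiffs_strong'[of 1]) (auto simp: sums_iff)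
    then have "(tail_series c has_field_derivative
            (\<Sum>n. diffs (\<lambda>n. if n < 2 then 0 else c n) n * 0 ^ n)) (at 0)"
      by (rule has_field_derivative_transform_within_open[of _ _ _ \<D>])
         (use tail_series_sums_full[OF c] in \<open>auto simp: sums_iff\<close>)
    then show ?thesis by (simp add: DERIV_imp_deriv diffs_def)
  qed
  have k0: "k 0 = 1" using ab by (simp add: k_def d0 harmonic_coeffs_def)
  have "Re (k (of_real r)) > 0"
  proof (rule ccontr)
    assume "\<not> Re (k (of_real r)) > 0"
    then obtain s where "0 \<le> s" "s \<le> r" "Re (k (of_real s)) = 0"
      using IVT2'[of "\<lambda>s. Re (k (of_real s))" r 0 0] ck r k0 by auto
    then show False using knz[of s] k0 r by (cases "s = 0") auto
  qed
  then show ?thesis using DH[of r] r by simp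
qed

text \<open>On the axis the denominator \<open>DH f\<close> is real and positive, so the lower bound
  for the real part of the quotient can be cleared of fractions. The result is linear in the
  coefficients.\<close>

lemma Sc_tau_axis_inequality:
  fixes C D r :: real
  assumes CD: "- D \<le> C" "C < D" "D \<le> 1" and r: "0 < r" "r < 1"
    and ab: "harmonic_coeffs f a b" and real: "\<And>m. m \<ge> 2 \<Longrightarrow> Im (a m) = 0 \<and> Im (b m) = 0"
    and F: "DH f \<in> SstarH C D"
  shows "(1 + C) * Re (DH f (of_real r)) < (1 + D) * Re (DH (DH f) (of_real r))"
proof -
  let ?r = "complex_of_real r"
  let ?q = "DH (DH f) ?r / DH f ?r"
  have r': "?r \<in> \<D> - {0}" using r by auto
  have pos: "0 < Re (DH f ?r)"
    using F by (intro DH_positive_on_axis[OF ab real _ r]) (auto simp: SstarH_def)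
  have "(\<lambda>z. if z = 0 then 1 else DH (DH f) z / DH f z) ` \<D>
      \<subseteq> (\<lambda>z. (1 + of_real C * z) / (1 + of_real D * z)) ` \<D>"
    using F by (simp add: SstarH_def subordinate_def)
  then have "(if ?r = 0 then 1 else ?q) \<in> (\<lambda>z. (1 + of_real C * z) / (1 + of_real D * z)) ` \<D>"
    by (rule subsetD[OF _ imageI]) (use r' in blast)
  then have "?q \<in> (\<lambda>z. (1 + of_real C * z) / (1 + of_real D * z)) ` \<D>"
    using r by (simp split: if_splits)
  then have gt: "(1 + C) / (1 + D) < Re ?q"
    using Re_janowski_gt[of D C] CD by auto
  have "Im (DH f ?r) = 0"
    by (rule harmonic_real_on_axis[OF DH_coeffs[OF ab]]) (use real r in auto)
  then have "Re ?q = Re (DH (DH f) ?r) / Re (DH f ?r)"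
    by (simp add: complex_is_Real_iff Re_divide_Reals)
  then have "(1 + C) / (1 + D) * Re (DH f ?r) < Re (DH (DH f) ?r)"
    using gt by (simp only: pos_less_divide_eq[OF pos])
  moreover have "0 < 1 + D" using CD by simp
  ultimately show ?thesis by (simp add: pos_divide_less_eq mult.commute)
qed

text \<open>Expanded in powers of r, the axis inequality bounds a series with nonnegative
  coefficients \<open>p m\<close> by (D - C) r. Each \<open>p m\<close> is at least
  \<open>K * s m\<close>, and dividing by \<open>K\<close> gives the constant
  \<open>k\<close>.\<close>

lemma Sc_tau_coeff_sum:
  fixes C D :: real
  assumes CD: "- D \<le> C" "C < D" "D \<le> 1" and f: "f \<in> Sc_tau C D" and ab: "harmonic_coeffs f a b"
  defines "k \<equiv> (D - C) / (2 * (1 + 2 * D - C))"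
  shows "summable (\<lambda>m. cmod (a (m + 2)) + cmod (b (m + 2)))"
    and "(\<Sum>m. cmod (a (m + 2)) + cmod (b (m + 2))) \<le> k"
proof -
  define s where "s = (\<lambda>m. cmod (a m) + cmod (b m))"
  define K where "K = 2 * (1 + 2 * D - C)"
  have K: "K > 0" using CD by (simp add: K_def)
  obtain a' b' where ab': "harmonic_coeffs f a' b'"
    and sgn: "\<And>m. m \<ge> 2 \<Longrightarrow> a' m = - complex_of_real (cmod (a' m)) \<and> b' m = - complex_of_real (cmod (b' m))"
    using f by (auto simp: Sc_tau_def tau1_def)
  have am: "a m = - of_real (cmod (a m))" and bm: "b m = - of_real (cmod (b m))" if "m \<ge> 2" for m
    using sgn[OF that] harmonic_coeffs_unique[OF ab ab' that] by simp_all
  have Rea: "Re (a m) = - cmod (a m)" and Reb: "Re (b m) = - cmod (b m)"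
    and Ima: "Im (a m) = 0" and Imb: "Im (b m) = 0" if "m \<ge> 2" for m
    using arg_cong[OF am[OF that], of Re] arg_cong[OF am[OF that], of Im]
      arg_cong[OF bm[OF that], of Re] arg_cong[OF bm[OF that], of Im] by simp_all
  \<comment> \<open>\<open>p m\<close> is the coefficient of r^m in (1 + C) Re DH f - (1 + D) Re DH
    (DH f), after inserting the signs of \<open>a\<close> and \<open>b\<close>.\<close>
  define p where "p = (\<lambda>m. real m * ((1 + D) * real m - (1 + C)) * cmod (a m)
                        + real m * ((1 + D) * real m + (1 + C)) * cmod (b m))"
  \<comment> \<open>\<open>K\<close> is the weight of \<open>cmod (a m)\<close> at
    \<open>m = 2\<close>, where that weight is smallest. The weight of \<open>cmod (b m)\<close> is
    at least as large because C >= -D >= -1.\<close>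
  have sp: "K * s m \<le> p m" if m: "m \<ge> 2" for m
  proof -
    have m': "real m \<ge> 2" using m by simp
    have 0: "(1 + D) * real m - (1 + C) \<ge> 1 + 2 * D - C"
      using mult_left_mono[OF m', of "1 + D"] CD by simp
    have 1: "K \<le> real m * ((1 + D) * real m - (1 + C))"
      unfolding K_def using m' 0 CD by (intro mult_mono) auto
    have 2: "K \<le> real m * ((1 + D) * real m + (1 + C))"
      by (rule order_trans[OF 1]) (use CD in \<open>intro mult_left_mono, auto\<close>)
    have "K * s m = K * cmod (a m) + K * cmod (b m)" by (simp add: s_def distrib_left)
    also have "\<dots> \<le> p m"
      unfolding p_def by (intro add_mono mult_right_mono 1 2) auto
    finally show ?thesis .
  qed
  \<comment> \<open>Convergence at r = 1 is not known beforehand. The limit is therefore taken in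
    finite sums, and the uniform bound on them then yields summability.\<close>
  have partial: "(\<Sum>m<N. s (m + 2)) \<le> k" for N
  proof -
    have le: "(\<Sum>m<N. s (m + 2) * r ^ (m + 2)) \<le> k" if r: "0 < r" "r < 1" for r
    proof -
      have F: "DH f \<in> SstarH C D" using f by (auto simp: Sc_tau_def ScH_def)
      have less: "(1 + C) * Re (DH f (of_real r)) < (1 + D) * Re (DH (DH f) (of_real r))"
        using Sc_tau_axis_inequality[OF CD r ab _ F] Ima Imb by blast
      have "(\<lambda>m. (1 + C) * (Re (of_nat (m + 2) * a (m + 2) + - (of_nat (m + 2) * b (m + 2))) * r ^ (m + 2))
              - (1 + D) * (Re (of_nat (m + 2) * (of_nat (m + 2) * a (m + 2))
                   + - (of_nat (m + 2) * (- (of_nat (m + 2) * b (m + 2))))) * r ^ (m + 2)))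
            sums ((1 + C) * (Re (DH f (of_real r)) - r) - (1 + D) * (Re (DH (DH f) (of_real r)) - r))"
        using r by (intro sums_diff sums_mult harmonic_coeffs_Re_sums DH_coeffs ab) auto
      also have "(\<lambda>m. (1 + C) * (Re (of_nat (m + 2) * a (m + 2) + - (of_nat (m + 2) * b (m + 2))) * r ^ (m + 2))
              - (1 + D) * (Re (of_nat (m + 2) * (of_nat (m + 2) * a (m + 2))
                   + - (of_nat (m + 2) * (- (of_nat (m + 2) * b (m + 2))))) * r ^ (m + 2)))
            = (\<lambda>m. p (m + 2) * r ^ (m + 2))"
      proof
        fix m :: nat
        define M where "M = m + 2"
        have M: "Re (a M) = - cmod (a M)" "Re (b M) = - cmod (b M)" "Im (a M) = 0" "Im (b M) = 0"
          using Rea[of M] Reb[of M] Ima[of M] Imb[of M] by (auto simp: M_def)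
        show "(1 + C) * (Re (of_nat (m + 2) * a (m + 2) + - (of_nat (m + 2) * b (m + 2))) * r ^ (m + 2))
              - (1 + D) * (Re (of_nat (m + 2) * (of_nat (m + 2) * a (m + 2))
                   + - (of_nat (m + 2) * (- (of_nat (m + 2) * b (m + 2))))) * r ^ (m + 2))
            = p (m + 2) * r ^ (m + 2)"
          unfolding M_def[symmetric] p_def using M by (simp add: algebra_simps)
      qed
      finally have sums: "(\<lambda>m. p (m + 2) * r ^ (m + 2)) sums
          ((1 + C) * (Re (DH f (of_real r)) - r) - (1 + D) * (Re (DH (DH f) (of_real r)) - r))" .
      have p0: "p (m + 2) \<ge> 0" for m
        using sp[of "m + 2"] K by (smt (verit) le_add2 mult_nonneg_nonneg norm_ge_zero s_def)
      have "K * (\<Sum>m<N. s (m + 2) * r ^ (m + 2)) \<le> (\<Sum>m<N. p (m + 2) * r ^ (m + 2))"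
        unfolding sum_distrib_left mult.assoc[symmetric]
        using sp r by (intro sum_mono mult_right_mono) auto
      also have "\<dots> \<le> (1 + C) * (Re (DH f (of_real r)) - r) - (1 + D) * (Re (DH (DH f) (of_real r)) - r)"
        using sums p0 r sum_le_suminf[of "\<lambda>m. p (m + 2) * r ^ (m + 2)" "{..<N}"] by (auto simp: sums_iff)
      also have "\<dots> \<le> (D - C) * r" using less by (simp add: algebra_simps)
      also have "\<dots> \<le> D - C" using r CD mult_left_mono[of r 1 "D - C"] by simp
      finally show ?thesis
        unfolding k_def K_def[symmetric] pos_le_divide_eq[OF K] by (simp add: mult.commute)
    qed
    have "((\<lambda>r. \<Sum>m<N. s (m + 2) * r ^ (m + 2)) \<longlongrightarrow> (\<Sum>m<N. s (m + 2) * 1 ^ (m + 2))) (at_left 1)"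
      by (intro tendsto_intros)
    moreover have "eventually (\<lambda>r. (\<Sum>m<N. s (m + 2) * r ^ (m + 2)) \<le> k) (at_left (1::real))"
      by (rule eventually_mono[OF eventually_at_left_real[OF zero_less_one]]) (intro le, auto)
    ultimately have "(\<Sum>m<N. s (m + 2) * 1 ^ (m + 2)) \<le> k"
      by (intro tendsto_upperbound) auto
    then show ?thesis by simp
  qed
  have "summable (\<lambda>m. s (m + 2))"
    by (rule summableI_nonneg_bounded[OF _ partial]) (simp add: s_def)
  then show "summable (\<lambda>m. cmod (a (m + 2)) + cmod (b (m + 2)))"
    and "(\<Sum>m. cmod (a (m + 2)) + cmod (b (m + 2))) \<le> k"
    using suminf_le_const[of "\<lambda>m. s (m + 2)" k] partial by (simp_all add: s_def)
qed

section \<open>Growth and the boundary of the image\<close>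

text \<open>All exponents are at least 2 and r lies in [0, 1), so every power of r is at most
  r^2.\<close>

lemma bohr_sum_le:
  assumes sm: "summable (\<lambda>m. cmod (a (m + 2)) + cmod (b (m + 2)))"
    and le: "(\<Sum>m. cmod (a (m + 2)) + cmod (b (m + 2))) \<le> k" and r: "0 \<le> r" "r < 1"
  shows "summable (\<lambda>m. (cmod (a (m + 2)) + cmod (b (m + 2))) * r ^ (m + 2))"
    and "bohr_sum a b r \<le> r + k * r\<^sup>2"
proof -
  let ?s = "\<lambda>m. cmod (a (m + 2)) + cmod (b (m + 2))"
  have le1: "?s m * r ^ (m + 2) \<le> ?s m * r\<^sup>2" for m
    using r by (intro mult_left_mono power_decreasing) auto
  have sm2: "summable (\<lambda>m. ?s m * r\<^sup>2)" using sm by (rule summable_mult2)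
  show sm1: "summable (\<lambda>m. ?s m * r ^ (m + 2))"
    by (rule summable_comparison_test'[OF sm2, of 0]) (use r le1 in \<open>simp add: abs_mult\<close>)
  have "(\<Sum>m. ?s m * r ^ (m + 2)) \<le> (\<Sum>m. ?s m * r\<^sup>2)"
    by (rule suminf_le[OF le1 sm1 sm2])
  also have "\<dots> = (\<Sum>m. ?s m) * r\<^sup>2" using suminf_mult2[OF sm] by simp
  also have "\<dots> \<le> k * r\<^sup>2" using le by (simp add: mult_right_mono)
  finally show "bohr_sum a b r \<le> r + k * r\<^sup>2" by (simp add: bohr_sum_def)
qed

text \<open>Estimating the deviation from the identity serves both sides of the growth estimate as
  well as the boundary distance.\<close>

lemma harmonic_growth:
  assumes ab: "harmonic_coeffs f a b"
    and sm: "summable (\<lambda>m. cmod (a (m + 2)) + cmod (b (m + 2)))"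
    and le: "(\<Sum>m. cmod (a (m + 2)) + cmod (b (m + 2))) \<le> k" and z: "cmod z < 1"
  shows "cmod (f z - z) \<le> k * (cmod z)\<^sup>2"
proof -
  let ?s = "\<lambda>m. cmod (a (m + 2)) + cmod (b (m + 2))"
  have "(\<lambda>m. a (m + 2) * z ^ (m + 2) + cnj (b (m + 2) * z ^ (m + 2))) sums
          (tail_series a z + cnj (tail_series b z))"
    using ab z by (intro sums_add sums_cnj[THEN iffD2] tail_series_sums) (auto simp: harmonic_coeffs_def)
  moreover have "f z - z = tail_series a z + cnj (tail_series b z)"
    using ab z by (simp add: harmonic_coeffs_def h_part_def g_part_def)
  ultimately have "f z - z = (\<Sum>m. a (m + 2) * z ^ (m + 2) + cnj (b (m + 2) * z ^ (m + 2)))"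
    by (simp add: sums_iff)
  also have "cmod \<dots> \<le> (\<Sum>m. ?s m * cmod z ^ (m + 2))"
  proof (rule norm_suminf_le)
    show "cmod (a (m + 2) * z ^ (m + 2) + cnj (b (m + 2) * z ^ (m + 2))) \<le> ?s m * cmod z ^ (m + 2)" for m
      by (rule order_trans[OF norm_triangle_ineq])
         (simp only: complex_mod_cnj norm_mult norm_power distrib_right order_refl)
    show "summable (\<lambda>m. ?s m * cmod z ^ (m + 2))"
      using bohr_sum_le(1)[OF sm le] z by simp
  qed
  also have "\<dots> \<le> k * (cmod z)\<^sup>2"
    using bohr_sum_le(2)[OF sm le, of "cmod z"] z by (simp add: bohr_sum_def)
  finally show ?thesis .
qed

lemma boundary_dist_ge:
  assumes cont: "continuous_on \<D> f" and inj: "inj_on f \<D>" and k: "0 \<le> k" "k \<le> 1 / 2"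
    and growth: "\<And>z. z \<in> \<D> \<Longrightarrow> cmod (f z - z) \<le> k * (cmod z)\<^sup>2"
  shows "1 - k \<le> boundary_dist f"
proof -
  have f0: "f 0 = 0" using growth[of 0] by simp
  have op: "open (f ` \<D>)" using invariance_of_domain[OF cont open_ball inj] .
  \<comment> \<open>\<open>infdist\<close> to the empty set is 0 by convention, so the frontier has
    to be nonempty; boundedness of the image ensures this.\<close>
  have "cmod (f z) \<le> 1 + k" if "z \<in> \<D>" for z
  proof -
    have "k * (cmod z)\<^sup>2 \<le> k * 1"
      using that k by (intro mult_left_mono) (auto simp: abs_square_le_1)
    then show ?thesis
      using growth[OF that] that norm_triangle_sub[of "f z" z] by simp
  qed
  then have "bounded (f ` \<D>)" unfolding bounded_iff by (intro exI[of _ "1 + k"]) auto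
  then have "f ` \<D> \<noteq> UNIV" using not_bounded_UNIV by metis
  then have ne: "frontier (f ` \<D>) \<noteq> {}" by (auto simp: frontier_eq_empty)
  have "1 - k \<le> cmod w" if w: "w \<in> frontier (f ` \<D>)" for w
  proof -
    have wn: "w \<notin> f ` \<D>" using w op by (simp add: frontier_def interior_open)
    have ge: "t - k * t\<^sup>2 \<le> cmod w" if t: "0 < t" "t < 1" for t
    proof -
      have sub: "cball 0 t \<subseteq> \<D>" using t by auto
      have "f ` \<D> \<subseteq> f ` cball 0 t \<union> {w. t - k * t\<^sup>2 \<le> cmod w}"
      proof clarsimp
        fix z assume z: "cmod z < 1" "f z \<notin> f ` cball 0 t"
        then have tz: "t < cmod z" by (meson image_eqI mem_cball_0 not_less)
        \<comment> \<open>\<open>t - k * t\<^sup>2\<close> increases on \<open>[0, 1]\<close> because \<open>k \<le> 1 / 2\<close>\<close>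
        have "k * (cmod z + t) \<le> 1 / 2 * 2"
          using k z t tz by (intro mult_mono) auto
        then have "0 \<le> (cmod z - t) * (1 - k * (cmod z + t))"
          using tz by (intro mult_nonneg_nonneg) auto
        then have "t - k * t\<^sup>2 \<le> cmod z - k * (cmod z)\<^sup>2"
          by (simp add: algebra_simps power2_eq_square)
        also have "\<dots> \<le> cmod (f z)"
          using growth[of z] z norm_triangle_sub[of z "f z"] by (simp add: norm_minus_commute)
        finally show "t - k * t\<^sup>2 \<le> cmod (f z)" .
      qed
      moreover have "closed (f ` cball 0 t \<union> {w. t - k * t\<^sup>2 \<le> cmod w})"
        using continuous_on_subset[OF cont sub]
        by (intro closed_Un compact_imp_closed compact_continuous_image closed_Collect_le continuous_intros)
           auto
      ultimately have "closure (f ` \<D>) \<subseteq> f ` cball 0 t \<union> {w. t - k * t\<^sup>2 \<le> cmod w}"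
        by (rule closure_minimal)
      then show ?thesis using w wn sub by (auto simp: frontier_def)
    qed
    have "((\<lambda>t. t - k * t\<^sup>2) \<longlongrightarrow> 1 - k * 1\<^sup>2) (at_left 1)"
      by (intro tendsto_intros)
    moreover have "eventually (\<lambda>t. t - k * t\<^sup>2 \<le> cmod w) (at_left (1::real))"
      using eventually_at_left_real[of 0 "1::real"] by (auto elim!: eventually_mono intro: ge)
    ultimately have "1 - k * 1\<^sup>2 \<le> cmod w"
      by (intro tendsto_upperbound) auto
    then show ?thesis by simp
  qed
  then show ?thesis
    unfolding boundary_dist_def f0 infdist_notempty[OF ne]
    using ne by (intro cINF_greatest) (auto simp: dist_norm)
qed

section \<open>The extremal function\<close>

text \<open>Leaving the coefficients at 0 and 1 free and fixing \<open>f\<close> on the disc only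
  makes this applicable to iterates of \<open>DH\<close>, which are known only there.\<close>

lemma quadratic_coeffs:
  fixes k :: complex
  assumes "a 2 = - k" and "\<And>m. m > 2 \<Longrightarrow> a m = 0" and "\<And>m. m \<ge> 2 \<Longrightarrow> b m = 0"
    and "\<And>z. z \<in> \<D> \<Longrightarrow> f z = z - k * z\<^sup>2"
  shows "harmonic_coeffs f a b"
proof -
  have a: "(\<lambda>m. a (m + 2) * z ^ (m + 2)) sums (- k * z\<^sup>2)" for z
    using sums_finite[of "{0::nat}" "\<lambda>m. a (m + 2) * z ^ (m + 2)"] assms(1,2) by (simp add: numeral_2_eq_2)
  have b: "(\<lambda>m. b (m + 2) * z ^ (m + 2)) sums 0" for z
    using assms(3) by simp
  show ?thesis
    using a b assms(4)
    by (auto simp: harmonic_coeffs_def tail_converges_def tail_series_def h_part_def g_part_def sums_iff)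
qed

text \<open>Each application of \<open>DH\<close> doubles the quadratic coefficient, so two of them
  lead from k to 4 k.\<close>

lemma DH_quadratic:
  assumes "\<And>z. z \<in> \<D> \<Longrightarrow> f z = z - k * z\<^sup>2" and z: "z \<in> \<D>"
  shows "DH f z = z - (2 * k) * z\<^sup>2"
proof -
  define a where "a = (\<lambda>m::nat. if m = 2 then - k else 0)"
  have "harmonic_coeffs f a (\<lambda>_. 0)"
    by (rule quadratic_coeffs[of _ k]) (auto simp: a_def assms)
  from DH_coeffs[OF this]
  have 1: "harmonic_coeffs (DH f) (\<lambda>m. of_nat m * a m) (\<lambda>_. 0)" by simp
  have 2: "harmonic_coeffs (\<lambda>z. z - (2 * k) * z\<^sup>2) (\<lambda>m. of_nat m * a m) (\<lambda>_. 0)"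
    by (rule quadratic_coeffs[of _ "2 * k"]) (auto simp: a_def)
  show ?thesis using 1 2 z by (simp add: harmonic_coeffs_def)
qed

text \<open>The difference of two values factors as (z - w)(1 - k (z + w)), and the second factor
  cannot vanish.\<close>

lemma inj_on_quadratic:
  assumes "cmod k \<le> 1 / 2"
  shows "inj_on (\<lambda>z. z - k * z\<^sup>2) \<D>"
proof (rule inj_onI)
  fix z w assume z: "z \<in> \<D>" and w: "w \<in> \<D>" and eq: "z - k * z\<^sup>2 = w - k * w\<^sup>2"
  have "cmod (z + w) < 2" using z w norm_triangle_ineq[of z w] by simp
  then have "cmod (k * (z + w)) < 1"
    using assms mult_right_mono[OF assms, of "cmod (z + w)"] by (simp add: norm_mult)
  then have "1 - k * (z + w) \<noteq> 0" by auto
  moreover have "(z - w) * (1 - k * (z + w)) = 0"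
    using eq by (simp add: algebra_simps power2_eq_square)
  ultimately show "z = w" by auto
qed

text \<open>The fraction is the quotient DH (DH f) / DH f for f(z) = z - k z^2, with the common
  factor z cancelled.\<close>

lemma quadratic_subordinate:
  fixes C D :: real
  assumes CD: "- D \<le> C" "C < D" "D \<le> 1" and z: "z \<in> \<D>"
  defines "k \<equiv> (D - C) / (2 * (1 + 2 * D - C))"
  shows "(1 - of_real (4 * k) * z) / (1 - of_real (2 * k) * z)
           \<in> (\<lambda>z. (1 + of_real C * z) / (1 + of_real D * z)) ` \<D>"
proof -
  define e where "e = 2 * D - C"
  have e: "e > 0" using CD by (simp add: e_def)
  have k: "2 * k * (1 + e) = D - C" using CD e by (simp add: k_def e_def field_simps)
  have z1: "cmod z < 1" using z by simp
  \<comment> \<open>Equating the Moebius map at \<open>\<omega>\<close> with the given fraction and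
    using \<open>2 * k * (1 + e) = D - C\<close> gives \<open>\<omega> = z / d\<close>. Since
    \<open>cmod d\<close> exceeds 1, \<open>\<omega>\<close> stays in the disc.\<close>
  define d where "d = of_real (1 + e) - of_real e * z"
  have "cmod (of_real e * z) = e * cmod z" using e by (simp add: norm_mult)
  then have "1 + e - e * cmod z \<le> cmod d"
    using norm_triangle_ineq2[of "of_real (1 + e)" "of_real e * z"] e by (simp add: d_def del: of_real_add)
  moreover have "e * cmod z < e * 1" using e z1 by (intro mult_strict_left_mono) auto
  ultimately have "1 < cmod d" by simp
  then have d: "cmod z < cmod d" "d \<noteq> 0" using z1 by auto
  \<comment> \<open>\<open>\<omega>\<close> is the preimage of the quotient under the Moebius map \<open>(1 + C z) / (1 + D z)\<close>\<close>
  define \<omega> where "\<omega> = z / d"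
  have \<omega>: "cmod \<omega> < 1" using d by (simp add: \<omega>_def norm_divide)
  have "(1 + of_real C * \<omega>) / (1 + of_real D * \<omega>) = (d + of_real C * z) / (d + of_real D * z)"
  proof -
    have "1 + of_real x * \<omega> = (d + of_real x * z) / d" for x
      using d by (simp add: \<omega>_def field_simps)
    then show ?thesis using d by simp
  qed
  also have "d + of_real C * z = of_real (1 + e) * (1 - of_real (4 * k) * z)"
  proof -
    have "d + of_real C * z = of_real (1 + e) - of_real (e - C) * z" by (simp add: d_def algebra_simps)
    also have "e - C = (1 + e) * (4 * k)" using k by (simp add: e_def algebra_simps)
    finally show ?thesis by (simp add: algebra_simps)
  qed
  also have "d + of_real D * z = of_real (1 + e) * (1 - of_real (2 * k) * z)"
  proof -
    have "d + of_real D * z = of_real (1 + e) - of_real (e - D) * z" by (simp add: d_def algebra_simps)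
    also have "e - D = (1 + e) * (2 * k)" using k by (simp add: e_def algebra_simps)
    finally show ?thesis by (simp add: algebra_simps)
  qed
  also have "of_real (1 + e) * (1 - of_real (4 * k) * z) / (of_real (1 + e) * (1 - of_real (2 * k) * z))
      = (1 - of_real (4 * k) * z) / (1 - of_real (2 * k) * z)"
    using e by (intro mult_divide_mult_cancel_left) (simp only: of_real_eq_0_iff)
  finally show ?thesis using \<omega> by (intro image_eqI[where x = \<omega>]) auto
qed

text \<open>Cleared of denominators, the upper bound says C >= -1.\<close>

lemma janowski_constant_bounds:
  fixes C D :: real
  assumes "- D \<le> C" "C < D" "D \<le> 1"
  defines "k \<equiv> (D - C) / (2 * (1 + 2 * D - C))"
  shows "0 < k" and "k \<le> 1 / 4"
  using assms by (auto simp: k_def field_simps)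

lemma quadratic_in_Sc_tau:
  fixes C D :: real
  assumes CD: "- D \<le> C" "C < D" "D \<le> 1"
  defines "k \<equiv> (D - C) / (2 * (1 + 2 * D - C))"
  shows "(\<lambda>z. z - of_real k * z\<^sup>2) \<in> Sc_tau C D"
proof -
  let ?f = "\<lambda>z. z - complex_of_real k * z\<^sup>2"
  define a where "a = (\<lambda>m::nat. if m = 2 then - complex_of_real k else 0)"
  have k: "0 < k" "k \<le> 1 / 4" using janowski_constant_bounds[OF CD] by (simp_all add: k_def)
  have ab: "harmonic_coeffs ?f a (\<lambda>_. 0)"
    by (rule quadratic_coeffs[of _ "of_real k"]) (auto simp: a_def)
  have tau: "?f \<in> tau1"
    unfolding tau1_def using k by (intro CollectI exI[of _ a] exI[of _ "\<lambda>_. 0"] conjI ab) (auto simp: a_def)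
  have DH1: "DH ?f z = z - of_real (2 * k) * z\<^sup>2" if "z \<in> \<D>" for z
    using DH_quadratic[of ?f "of_real k" z] that by simp
  have DH2: "DH (DH ?f) z = z - of_real (4 * k) * z\<^sup>2" if "z \<in> \<D>" for z
    using DH_quadratic[of "DH ?f" "of_real (2 * k)" z] that DH1 by simp
  have nz: "1 - of_real (2 * k) * z \<noteq> 0" if "z \<in> \<D>" for z
  proof -
    have "cmod (of_real (2 * k) * z) = 2 * k * cmod z" using k by (simp add: norm_mult)
    also have "\<dots> < 1" using mult_mono[of "2 * k" "1 / 2" "cmod z" 1] k that by simp
    finally show ?thesis by auto
  qed
  have DH_factor: "DH ?f z = z * (1 - of_real (2 * k) * z)"
      "DH (DH ?f) z = z * (1 - of_real (4 * k) * z)" if "z \<in> \<D>" for z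
    using DH1[OF that] DH2[OF that] by (simp_all add: algebra_simps power2_eq_square)
  \<comment> \<open>The value 1 prescribed at the origin agrees with the cancelled fraction, so one
    formula covers the whole disc.\<close>
  have quot: "(if z = 0 then 1 else DH (DH ?f) z / DH ?f z)
      = (1 - of_real (4 * k) * z) / (1 - of_real (2 * k) * z)" if "z \<in> \<D>" for z
    unfolding DH_factor[OF that] by simp
  have "DH ?f \<in> SstarH C D"
    unfolding SstarH_def subordinate_def
  proof (intro CollectI conjI ballI)
    show "DH ?f \<in> H0" using DH_coeffs[OF ab] by (auto simp: H0_def)
    show "DH ?f z \<noteq> 0" if "z \<in> \<D> - {0}" for z
      using nz[of z] that DH_factor(1)[of z] by auto
    show "(\<lambda>z. if z = 0 then 1 else DH (DH ?f) z / DH ?f z) ` \<D>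
        \<subseteq> (\<lambda>z. (1 + of_real C * z) / (1 + of_real D * z)) ` \<D>"
    proof (rule image_subsetI)
      fix z :: complex assume "z \<in> \<D>"
      from quadratic_subordinate[OF CD this, folded k_def] show "(if z = 0 then 1 else DH (DH ?f) z / DH ?f z)
          \<in> (\<lambda>z. (1 + of_real C * z) / (1 + of_real D * z)) ` \<D>"
        unfolding quot[OF \<open>z \<in> \<D>\<close>] .
    qed
  qed simp
  moreover have "?f \<in> SH0"
    using ab inj_on_quadratic[of "of_real k"] k by (auto simp: SH0_def H0_def)
  ultimately show ?thesis using tau by (simp add: Sc_tau_def ScH_def)
qed

text \<open>The point 1 - k, the value at 1, is a limit of image points but is not attained in the
  disc, so it lies on the frontier.\<close>

lemma quadratic_boundary_dist_le:
  fixes k :: real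
  assumes k: "0 < k" "k < 1 / 2"
  shows "boundary_dist (\<lambda>z. z - of_real k * z\<^sup>2) \<le> 1 - k"
proof -
  let ?f = "\<lambda>z. z - complex_of_real k * z\<^sup>2"
  have "?f 1 \<notin> ?f ` \<D>"
  proof
    assume "?f 1 \<in> ?f ` \<D>"
    then obtain z where z: "z \<in> \<D>" "?f 1 = ?f z" by blast
    have "cmod (of_real k * (1 + z)) = k * cmod (1 + z)" using k by (simp add: norm_mult)
    also have "\<dots> \<le> k * 2"
      using k z norm_triangle_ineq[of 1 z] by (intro mult_left_mono) auto
    also have "\<dots> < 1" using k by simp
    finally have "1 - of_real k * (1 + z) \<noteq> 0" by auto
    moreover have "(1 - z) * (1 - of_real k * (1 + z)) = 0"
      using z(2) by (simp add: algebra_simps power2_eq_square)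
    ultimately show False using z(1) by auto
  qed
  moreover have "?f 1 \<in> closure (?f ` \<D>)"
  proof -
    have "?f ` closure \<D> \<subseteq> closure (?f ` \<D>)"
      by (intro image_closure_subset closure_subset continuous_intros closed_closure)
    moreover have "?f 1 \<in> ?f ` closure \<D>" by (rule imageI) simp
    ultimately show ?thesis by blast
  qed
  ultimately have "?f 1 \<in> frontier (?f ` \<D>)"
    using interior_subset by (auto simp: frontier_def)
  then have "boundary_dist ?f \<le> dist (?f 0) (?f 1)"
    unfolding boundary_dist_def by (rule infdist_le)
  also have "dist (?f 0) (?f 1) = cmod (of_real (1 - k))" by (simp add: dist_norm norm_minus_commute)
  also have "\<dots> = 1 - k" unfolding norm_of_real using k by simp
  finally show ?thesis .
qed

section \<open>The Bohr radius\<close>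

text \<open>\<open>t\<close> is the positive root of k t^2 + t - (1 - k), whose discriminant is 1 +
  4 k (1 - k).\<close>

lemma bohr_root:
  fixes k t r :: real
  assumes k: "0 < k" "k \<le> 1 / 4" and "t = (- 1 + sqrt (1 + 4 * k * (1 - k))) / (2 * k)"
  shows "0 < t" and "t < 1" and "t + k * t\<^sup>2 = 1 - k"
proof -
  define q where "q = sqrt (1 + 4 * k * (1 - k))"
  have pos: "0 < 4 * k * (1 - k)" using k by simp
  have q1: "1 < q" unfolding q_def using pos by simp
  have q2: "q\<^sup>2 = 1 + 4 * k * (1 - k)" unfolding q_def using pos by simp
  have t: "2 * k * t = q - 1" using assms by (simp add: q_def)
  \<comment> \<open>This is the condition t < 1 rewritten through 2 k t = q - 1.\<close>
  have "q\<^sup>2 < (1 + 2 * k)\<^sup>2"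
    unfolding q2 using k by (simp add: power2_eq_square algebra_simps)
  then have "q < 1 + 2 * k" using k by (intro power_less_imp_less_base[of q 2]) auto
  then have "2 * k * t < 2 * k * 1" using t by simp
  then show "t < 1" using k by simp
  have "0 < 2 * k * t" using t q1 by simp
  then show "0 < t" using k by (simp add: zero_less_mult_iff)
  have "4 * k * (t + k * t\<^sup>2) = (2 * k * t + 1)\<^sup>2 - 1" by (simp add: power2_eq_square algebra_simps)
  also have "\<dots> = 4 * k * (1 - k)" using t q2 by simp
  finally show "t + k * t\<^sup>2 = 1 - k" using k by simp
qed

lemma add_square_mono:
  fixes k r s :: real
  assumes "0 \<le> k" "0 \<le> r"
  shows "r \<le> s \<Longrightarrow> r + k * r\<^sup>2 \<le> s + k * s\<^sup>2" and "r < s \<Longrightarrow> r + k * r\<^sup>2 < s + k * s\<^sup>2"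
  using assms by (auto intro!: add_mono add_less_le_mono mult_left_mono power_mono)

theorem theorem2p6:
  fixes C D \<alpha>\<^sub>2 rstar :: real and f0 :: "complex \<Rightarrow> complex"
  assumes "- D \<le> C" and "C < D" and "D \<le> 1"
    and "\<alpha>\<^sub>2 = 1 + 2 * D - C"
    and "rstar = (- 1 + sqrt (1 + 2 * ((D - C) / \<alpha>\<^sub>2) * (1 - (D - C) / (2 * \<alpha>\<^sub>2)))) / ((D - C) / \<alpha>\<^sub>2)"
    and "f0 = (\<lambda>z. z - of_real ((D - C) / (2 * (1 + 2 * D - C))) * z ^ 2)"
  shows "(\<forall>f\<in>Sc_tau C D. \<forall>a b. harmonic_coeffs f a b \<longrightarrow>
            (\<forall>z r. cmod z = r \<and> r < 1 \<longrightarrow>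
               r - (D - C) / (2 * (1 + 2 * D - C)) * r ^ 2 \<le> cmod (f z) \<and>
               cmod (f z) \<le> r + (D - C) / (2 * (1 + 2 * D - C)) * r ^ 2) \<and>
            (\<forall>z. cmod z \<le> rstar \<longrightarrow> bohr_sum a b (cmod z) \<le> boundary_dist f))
       \<and> is_bohr_radius (Sc_tau C D) rstar
       \<and> f0 \<in> Sc_tau C D
       \<and> (\<forall>a b. harmonic_coeffs f0 a b \<longrightarrow>
            (\<forall>z. cmod z = rstar \<longrightarrow> bohr_sum a b (cmod z) = boundary_dist f0) \<and>
            (\<forall>z. rstar < cmod z \<and> cmod z < 1 \<longrightarrow> \<not> bohr_sum a b (cmod z) \<le> boundary_dist f0))"
proof -
  note CD = assms(1-3)
  define k where "k = (D - C) / (2 * (1 + 2 * D - C))"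
  have k: "0 < k" "k \<le> 1 / 4" using janowski_constant_bounds[OF CD] by (simp_all add: k_def)
  have k2: "(D - C) / (2 * \<alpha>\<^sub>2) = k" by (simp only: k_def assms(4))
  then have k2': "(D - C) / \<alpha>\<^sub>2 = 2 * k" by auto
  have "rstar = (- 1 + sqrt (1 + 4 * k * (1 - k))) / (2 * k)"
    unfolding assms(5) k2 k2' by simp
  note rstar = bohr_root[OF k this]
  have f0: "f0 = (\<lambda>z. z - of_real k * z\<^sup>2)" using assms(6) by (simp add: k_def)
  have f0_in: "f0 \<in> Sc_tau C D"
    unfolding f0 k_def by (rule quadratic_in_Sc_tau[OF CD])

  have growth: "cmod (f z - z) \<le> k * (cmod z)\<^sup>2"
    if "f \<in> Sc_tau C D" "harmonic_coeffs f a b" "cmod z < 1" for f a b z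
    using harmonic_growth[OF that(2) Sc_tau_coeff_sum[OF CD that(1,2)] that(3)] by (simp add: k_def)
  have dist: "1 - k \<le> boundary_dist f" if f: "f \<in> Sc_tau C D" for f
  proof -
    obtain a b where ab: "harmonic_coeffs f a b" using f by (auto simp: Sc_tau_def tau1_def)
    show ?thesis
      using f k growth[OF f ab]
      by (intro boundary_dist_ge harmonic_coeffs_continuous[OF ab]) (auto simp: Sc_tau_def ScH_def SH0_def)
  qed
  have bohr: "bohr_sum a b (cmod z) \<le> boundary_dist f"
    if "f \<in> Sc_tau C D" "harmonic_coeffs f a b" "cmod z \<le> rstar" for f a b z
  proof -
    have "bohr_sum a b (cmod z) \<le> cmod z + k * (cmod z)\<^sup>2"
      using bohr_sum_le(2)[OF Sc_tau_coeff_sum[OF CD that(1,2)], of "cmod z"] that(3) rstar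
      by (simp add: k_def)
    also have "\<dots> \<le> rstar + k * rstar\<^sup>2" using k that(3) by (intro add_square_mono) auto
    also have "\<dots> \<le> boundary_dist f" using rstar dist[OF that(1)] by simp
    finally show ?thesis .
  qed
  \<comment> \<open>The lower bound valid for the whole class meets the upper bound given by the
    frontier point 1 - k.\<close>
  have dist0: "boundary_dist f0 = 1 - k"
    using dist[OF f0_in] quadratic_boundary_dist_le[of k] k by (simp add: f0)
  \<comment> \<open>\<open>bohr_sum\<close> reads coefficients from index 2 on only, and there
    uniqueness forces the explicit sequence \<open>a'\<close> and zero.\<close>
  have bohr0: "bohr_sum a b r = r + k * r\<^sup>2" if ab: "harmonic_coeffs f0 a b" for a b r
  proof -
    define a' where "a' = (\<lambda>m::nat. if m = 2 then - complex_of_real k else 0)"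
    have "harmonic_coeffs f0 a' (\<lambda>_. 0)"
      by (rule quadratic_coeffs[of _ "of_real k"]) (auto simp: a'_def f0)
    then have "a (m + 2) = a' (m + 2)" "b (m + 2) = 0" for m
      using harmonic_coeffs_unique[OF ab, of a' "\<lambda>_. 0" "m + 2"] by auto
    then have "bohr_sum a b r = r + (\<Sum>m. cmod (a' (m + 2)) * r ^ (m + 2))"
      by (simp add: bohr_sum_def)
    also have "(\<Sum>m. cmod (a' (m + 2)) * r ^ (m + 2)) = k * r\<^sup>2"
      using suminf_finite[of "{0::nat}" "\<lambda>m. cmod (a' (m + 2)) * r ^ (m + 2)"] k
      by (simp add: a'_def numeral_2_eq_2)
    finally show ?thesis .
  qed
  have sharp: "\<not> bohr_sum a b r \<le> boundary_dist f0" if "harmonic_coeffs f0 a b" "rstar < r" for a b r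
    using add_square_mono(2)[of k rstar r] k rstar that by (simp add: bohr0 dist0)

  have "is_bohr_radius (Sc_tau C D) rstar"
    unfolding is_bohr_radius_def
  proof (intro conjI ballI)
    show "rstar \<in> bohr_radii (Sc_tau C D)" using rstar bohr by (auto simp: bohr_radii_def)
    \<comment> \<open>The single member \<open>f0\<close>, tested at the real point
      \<open>\<rho>\<close>, already excludes every radius beyond \<open>rstar\<close>.\<close>
    fix \<rho> assume \<rho>: "\<rho> \<in> bohr_radii (Sc_tau C D)"
    obtain a b where ab: "harmonic_coeffs f0 a b" using f0_in by (auto simp: Sc_tau_def tau1_def)
    have \<rho>0: "0 < \<rho>" using \<rho> by (simp add: bohr_radii_def)
    have "\<forall>z. cmod z \<le> \<rho> \<longrightarrow> bohr_sum a b (cmod z) \<le> boundary_dist f0"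
      using \<rho> f0_in ab unfolding bohr_radii_def by blast
    from this[rule_format, of "of_real \<rho>"] \<rho>0 have "bohr_sum a b \<rho> \<le> boundary_dist f0" by simp
    then show "\<rho> \<le> rstar" using sharp[OF ab, of \<rho>] by force
  qed
  moreover have "cmod z - k * (cmod z)\<^sup>2 \<le> cmod (f z) \<and> cmod (f z) \<le> cmod z + k * (cmod z)\<^sup>2"
    if "f \<in> Sc_tau C D" "harmonic_coeffs f a b" "cmod z < 1" for f a b z
    using growth[OF that] norm_triangle_sub[of "f z" z] norm_triangle_sub[of z "f z"]
    by (simp add: norm_minus_commute)
  ultimately show ?thesis
    unfolding k_def[symmetric] using bohr f0_in sharp bohr0 dist0 rstar by auto
qed

end
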